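(* Let $(x_{\ell,\circ},x_\circ,v_{\ell,\circ},v_\circ)\in\mathcal S$. The system $$\dot x_\ell=v_\ell,\quad \dot v_\ell=\mathsf a_\ell,\quad \dot x=v,\quad \dot v=\mathcal A(x_\ell,x,v_\ell,v;u),\quad (x_\ell(0),x(0),v_\ell(0),v(0))=(x_{\ell,\circ},x_\circ,v_{\ell,\circ},v_\circ)$$ has a unique $\mathcal S$-valued solution up to the collision time $\mathcal T=\inf\{t>0:\ x_\ell(t)-x(t)=0\}$. Precisely: either there is a unique solution on $[0,T]$ with values in $\mathcal S$ (no collision in $[0,T]$, so $\mathcal T>T$), or there is $\mathcal T\in(0,T]$ and a unique solution on $[0,\mathcal T)$ with values in $\mathcal S$ such that $x_\ell(t)-x(t)\to0$ as $t\uparrow\mathcal T$.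
   Context: Fixed data: constants $k_v,k_d,k,\tau_s>0$; constants $0<\underline u<\bar u<\bar v<\infty$; a time horizon $T>0$; a control $u\in C([0,T];[\underline u,\bar u])$; a leader acceleration $\mathsf a_\ell\in C([0,T];\mathbb R)\cap L^\infty([0,T];\mathbb R)$ such that $0\le v_{\ell,\circ}+\int_0^t\mathsf a_\ell(s)\,ds\le\bar v$ for all $t\in[0,T]$. The acceleration of the following vehicle is $$\mathcal A(x_\ell,x,v_\ell,v;u)=\min\Bigl\{k_v\frac{v_\ell-v}{(x_\ell-x)^2}+k_d(x_\ell-x-\tau_s v),\;k(u-v)\Bigr\},$$ where $u=u(t)$ is evaluated at the current time. The state space is $\mathcal S=\{(x_1,x_2,v_1,v_2)\in\mathbb R^2\times\mathbb R_+^2:\ x_1-x_2>0,\ v_1,v_2\in[0,\bar v]\}$, with $\mathbb R_+=[0,\infty)$. A solution on an interval $J\subset[0,T]$ containing $0$ is a continuous function $(x_\ell,x,v_\ell,v):J\to\mathcal S$, of class $W^{1,\infty}$ on compact subintervals of $J$, satisfying the system in integral form: for all $t\in J$, $x_\ell(t)=x_{\ell,\circ}+\int_0^t v_\ell\,ds$, $v_\ell(t)=v_{\ell,\circ}+\int_0^t\mathsf a_\ell\,ds$, $x(t)=x_\circ+\int_0^t v\,ds$, $v(t)=v_\circ+\int_0^t\mathcal A(x_\ell,x,v_\ell,v;u)\,ds$. *)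

theory Defs
  imports "HOL-Analysis.Analysis"
begin

definition state_space :: "real \<Rightarrow> (real \<times> real \<times> real \<times> real) set" where
  "state_space vmax =
     {(x1, x2, v1, v2). x1 - x2 > 0 \<and> v1 \<in> {0..vmax} \<and> v2 \<in> {0..vmax}}"

definition acceleration ::
  "real \<Rightarrow> real \<Rightarrow> real \<Rightarrow> real \<Rightarrow> real \<Rightarrow> real \<Rightarrow> real \<Rightarrow> real \<Rightarrow> real \<Rightarrow> real" where
  "acceleration kv kd k \<tau>s xl x vl v u =
     min (kv * ((vl - v) / (xl - x)\<^sup>2) + kd * (xl - x - \<tau>s * v)) (k * (u - v))"

definition L_infinity :: "real set \<Rightarrow> (real \<Rightarrow> real) set" where
  "L_infinity S =
     {f. f \<in> borel_measurable (lebesgue_on S) \<and>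
         (\<exists>C. AE t in lebesgue_on S. \<bar>f t\<bar> \<le> C)}"

definition test_function :: "real \<Rightarrow> real \<Rightarrow> (real \<Rightarrow> real) \<Rightarrow> bool" where
  "test_function a b \<phi> \<longleftrightarrow>
     (\<forall>n t. (deriv ^^ n) \<phi> field_differentiable at t) \<and>
     closure {t. \<phi> t \<noteq> 0} \<subseteq> {a<..<b}"

definition weak_derivative ::
  "real \<Rightarrow> real \<Rightarrow> (real \<Rightarrow> real) \<Rightarrow> (real \<Rightarrow> real) \<Rightarrow> bool" where
  "weak_derivative a b f g \<longleftrightarrow>
     (\<forall>\<phi>. test_function a b \<phi> \<longrightarrow>
        (LINT t|lebesgue_on {a<..<b}. f t * deriv \<phi> t) =
        - (LINT t|lebesgue_on {a<..<b}. g t * \<phi> t))"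

definition W1_infinity :: "real \<Rightarrow> real \<Rightarrow> (real \<Rightarrow> real) set" where
  "W1_infinity a b =
     {f. f \<in> L_infinity {a<..<b} \<and> (\<exists>g \<in> L_infinity {a<..<b}. weak_derivative a b f g)}"

definition solution ::
  "real \<Rightarrow> real \<Rightarrow> real \<Rightarrow> real \<Rightarrow> real \<Rightarrow> real \<Rightarrow> (real \<Rightarrow> real) \<Rightarrow> (real \<Rightarrow> real) \<Rightarrow>
   real \<Rightarrow> real \<Rightarrow> real \<Rightarrow> real \<Rightarrow> real set \<Rightarrow>
   (real \<Rightarrow> real) \<Rightarrow> (real \<Rightarrow> real) \<Rightarrow> (real \<Rightarrow> real) \<Rightarrow> (real \<Rightarrow> real) \<Rightarrow> bool" where
  "solution kv kd k \<tau>s vmax T u al xl0 x0 vl0 v0 J xl x vl v \<longleftrightarrow>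
     is_interval J \<and> 0 \<in> J \<and> J \<subseteq> {0..T} \<and>
     continuous_on J (\<lambda>t. (xl t, x t, vl t, v t)) \<and>
     (\<forall>t\<in>J. (xl t, x t, vl t, v t) \<in> state_space vmax) \<and>
     (\<forall>a b. a < b \<and> {a..b} \<subseteq> J \<longrightarrow> {xl, x, vl, v} \<subseteq> W1_infinity a b) \<and>
     (\<forall>t\<in>J.
        xl t = xl0 + integral {0..t} vl \<and>
        vl t = vl0 + integral {0..t} al \<and>
        x t = x0 + integral {0..t} v \<and>
        v t = v0 + integral {0..t}
                (\<lambda>s. acceleration kv kd k \<tau>s (xl s) (x s) (vl s) (v s) (u s)))"

text \<open>Solutions are total functions whose values outside \<open>J\<close> are irrelevant,
  so uniqueness means equality on \<open>J\<close>.\<close>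

definition unique_solution ::
  "real \<Rightarrow> real \<Rightarrow> real \<Rightarrow> real \<Rightarrow> real \<Rightarrow> real \<Rightarrow> (real \<Rightarrow> real) \<Rightarrow> (real \<Rightarrow> real) \<Rightarrow>
   real \<Rightarrow> real \<Rightarrow> real \<Rightarrow> real \<Rightarrow> real set \<Rightarrow>
   (real \<Rightarrow> real) \<Rightarrow> (real \<Rightarrow> real) \<Rightarrow> (real \<Rightarrow> real) \<Rightarrow> (real \<Rightarrow> real) \<Rightarrow> bool" where
  "unique_solution kv kd k \<tau>s vmax T u al xl0 x0 vl0 v0 J xl x vl v \<longleftrightarrow>
     solution kv kd k \<tau>s vmax T u al xl0 x0 vl0 v0 J xl x vl v \<and>
     (\<forall>xl' x' vl' v'.
        solution kv kd k \<tau>s vmax T u al xl0 x0 vl0 v0 J xl' x' vl' v' \<longrightarrow>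
        (\<forall>t\<in>J. xl' t = xl t \<and> x' t = x t \<and> vl' t = vl t \<and> v' t = v t))"

text \<open>An \<open>\<S>\<close>-valued solution has a positive gap on all of \<open>J\<close>, so the
  infimum of \<open>{t > 0. xl t - x t = 0}\<close> has to be read for the continuous extension of the
  gap to the closure of \<open>J\<close>: this is the limit below, which is just the value when \<open>t \<in> J\<close>.
  The infimum is \<open>\<infinity>\<close> if there is no collision.\<close>

definition collision_time :: "real set \<Rightarrow> (real \<Rightarrow> real) \<Rightarrow> (real \<Rightarrow> real) \<Rightarrow> ereal" where
  "collision_time J xl x =
     (INF t \<in> {t. t > 0 \<and> t \<in> closure J \<and> ((\<lambda>s. xl s - x s) \<longlongrightarrow> 0) (at t within J)}. ereal t)"

end

theory Submission
  imports Defs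
begin

text \<open>
  The leader's trajectory is given by integrating its acceleration twice, so only the follower's
  position and speed \<open>(x, v)\<close> are unknown. The right-hand side for them is singular only where
  the gap \<open>XL t - x\<close> vanishes. Replacing the gap by its maximum with some \<open>\<epsilon> > 0\<close>, and the speed
  inside the acceleration by its projection to \<open>[0, vmax]\<close>, gives a globally Lipschitz system; it
  has exactly one solution on \<open>[0, T]\<close> (\<open>floored_solution_exists\<close>, \<open>floored_solution_unique\<close>,
  both by contraction in an exponentially weighted sup norm).

  The speed projection is harmless: at speed \<open>0\<close> both branches of the minimum are nonnegative, and
  at speed \<open>vmax\<close> the free-flow branch \<open>k (u - v)\<close> is negative, so the speed of a floored
  solution never leaves \<open>[0, vmax]\<close> (\<open>floored_solution_velocity\<close>). Hence floored solutions and
  true solutions are the same thing as long as the gap is at least \<open>\<epsilon>\<close>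
  (\<open>sol_imp_floored_solution\<close>, \<open>floored_solution_imp_sol\<close>). On a compact interval the gap of a
  true solution has a positive minimum, which gives uniqueness (\<open>sol_unique\<close>).

  A solution whose gap stays above some \<open>m > 0\<close> up to time \<open>b\<close> can be continued beyond \<open>b\<close>: it
  agrees with the solution floored at \<open>m / 2\<close>, whose gap exceeds \<open>m / 2\<close> for a while longer
  (\<open>sol_extend\<close>). Let \<open>b\<close> be the supremum of the times up to which a solution exists. If no
  solution reaches \<open>T\<close>, the solutions before \<open>b\<close> glue to one on \<open>[0, b)\<close> (\<open>sol_glue\<close>), and its
  gap is not bounded away from \<open>0\<close>. As the gap grows at rate at most \<open>vmax\<close>, a gap that gets small
  close to \<open>b\<close> remains small, so it tends to \<open>0\<close> at \<open>b\<close> (\<open>sol_gap_tendsto_0\<close>).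
\<close>

section \<open>Integral equations with a globally Lipschitz right-hand side\<close>

text \<open>Integrating an \<open>L\<close>-Lipschitz right-hand side multiplies distances by at most \<open>L / c\<close> when norms
  are weighted by \<open>exp (- c t)\<close>. With \<open>c = 2 L\<close> this is the contraction by \<open>1 / 2\<close> behind both uniqueness and
  existence.\<close>
lemma exp_integral_bound:
  fixes f :: "real \<Rightarrow> 'a::banach"
  assumes "0 \<le> t" "0 < c" "continuous_on {0..t} f"
    and "\<And>s. s \<in> {0..t} \<Longrightarrow> norm (f s) \<le> K * exp (c * s)" and "0 \<le> K"
  shows "norm (integral {0..t} f) \<le> K / c * exp (c * t)"
proof -
  have "((\<lambda>s. K * exp (c * s)) has_integral (K / c * exp (c * t) - K / c * exp (c * 0))) {0..t}"
    using assms(1,2)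
    by (intro fundamental_theorem_of_calculus)
       (auto intro!: derivative_eq_intros simp: has_real_derivative_iff_has_vector_derivative[symmetric])
  then have "norm (integral {0..t} f) \<le> K / c * exp (c * t) - K / c * exp (c * 0)"
    using integral_norm_bound_integral[of f "{0..t}" "\<lambda>s. K * exp (c * s)"] assms
    by (auto simp: integrable_continuous_real has_integral_iff)
  also have "\<dots> \<le> K / c * exp (c * t)"
    using assms(2,5) by simp
  finally show ?thesis .
qed

text \<open>At a maximum of the weighted distance between two solutions, integrating the Lipschitz estimate
  bounds this maximum by half of itself.\<close>
lemma integral_equation_unique:
  fixes F :: "real \<Rightarrow> 'a::banach \<Rightarrow> 'a"
  assumes "0 \<le> b" "0 < L"
    and contF: "continuous_on ({0..b} \<times> UNIV) (\<lambda>(t, y). F t y)"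
    and lip: "\<And>t y z. t \<in> {0..b} \<Longrightarrow> norm (F t y - F t z) \<le> L * norm (y - z)"
    and y: "continuous_on {0..b} y" "\<And>t. t \<in> {0..b} \<Longrightarrow> y t = y0 + integral {0..t} (\<lambda>s. F s (y s))"
    and z: "continuous_on {0..b} z" "\<And>t. t \<in> {0..b} \<Longrightarrow> z t = y0 + integral {0..t} (\<lambda>s. F s (z s))"
    and "t \<in> {0..b}"
  shows "y t = z t"
proof -
  define w where "w t = exp (- (2 * L * t)) * norm (y t - z t)" for t
  have comp: "continuous_on {0..t} (\<lambda>s. F s (g s))"
    if "continuous_on {0..b} g" "t \<in> {0..b}" for g t
  proof -
    have "continuous_on {0..t} (\<lambda>s. (s, g s))"
      using that by (auto intro!: continuous_intros elim!: continuous_on_subset)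
    from continuous_on_compose2[OF contF this] that show ?thesis by fastforce
  qed
  have "continuous_on {0..b} w"
    unfolding w_def using y(1) z(1) by (intro continuous_intros)
  then obtain m where m: "m \<in> {0..b}" "\<And>t. t \<in> {0..b} \<Longrightarrow> w t \<le> w m"
    using continuous_attains_sup[of "{0..b}" w] \<open>0 \<le> b\<close> by auto
  have norm_eq: "norm (y t - z t) = w t * exp (2 * L * t)" for t
    by (simp add: w_def exp_minus)
  have int: "y m - z m = integral {0..m} (\<lambda>s. F s (y s) - F s (z s))"
    using m(1) comp[OF y(1) m(1)] comp[OF z(1) m(1)] y(2)[OF m(1)] z(2)[OF m(1)]
    by (simp add: integral_diff integrable_continuous_real)
  have "norm (y m - z m) \<le> (L * w m) / (2 * L) * exp (2 * L * m)"
    unfolding int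
  proof (rule exp_integral_bound)
    show "continuous_on {0..m} (\<lambda>s. F s (y s) - F s (z s))"
      using comp[OF y(1) m(1)] comp[OF z(1) m(1)] by (intro continuous_intros)
    fix s assume s: "s \<in> {0..m}"
    have "norm (F s (y s) - F s (z s)) \<le> L * norm (y s - z s)"
      using lip s m(1) by auto
    also have "\<dots> \<le> L * (w m * exp (2 * L * s))"
      using m s \<open>0 < L\<close> by (simp add: norm_eq)
    finally show "norm (F s (y s) - F s (z s)) \<le> L * w m * exp (2 * L * s)" by simp
  qed (use m \<open>0 < L\<close> in \<open>auto simp: w_def\<close>)
  then have "w m * exp (2 * L * m) \<le> w m / 2 * exp (2 * L * m)"
    using \<open>0 < L\<close> by (simp add: norm_eq)
  then have "w m \<le> w m / 2"
    by (rule mult_right_le_imp_le) simp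
  then have "w t \<le> 0"
    using m(2)[OF \<open>t \<in> {0..b}\<close>] by simp
  then show ?thesis
    by (simp add: w_def mult_le_0_iff)
qed

text \<open>The Picard operator acts on the weighted unknown \<open>z t = exp (- 2 L t) y t\<close>. Clamping the time to
  \<open>[0, T]\<close> extends its values to bounded continuous functions on the whole line, so that the
  Banach fixed point theorem applies to a complete type.\<close>
lemma integral_equation_exists:
  fixes F :: "real \<Rightarrow> 'a::banach \<Rightarrow> 'a"
  assumes "0 \<le> T" "0 < L"
    and contF: "continuous_on ({0..T} \<times> UNIV) (\<lambda>(t, y). F t y)"
    and lip: "\<And>t y z. t \<in> {0..T} \<Longrightarrow> norm (F t y - F t z) \<le> L * norm (y - z)"
  obtains y where "continuous_on {0..T} y"
    "\<And>t. t \<in> {0..T} \<Longrightarrow> y t = y0 + integral {0..t} (\<lambda>s. F s (y s))"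
proof -
  define c where "c t = max 0 (min T t)" for t
  define G where "G z s = F s (exp (2 * L * s) *\<^sub>R z s)" for z s
  define \<Phi> where "\<Phi> z t = exp (- (2 * L * c t)) *\<^sub>R (y0 + integral {0..c t} (G z))" for z t
  have c: "c t \<in> {0..T}" for t
    using \<open>0 \<le> T\<close> by (auto simp: c_def)
  have contG: "continuous_on {0..t} (G z)" if "continuous_on UNIV z" "t \<in> {0..T}" for z t
  proof -
    have "continuous_on {0..t} (\<lambda>s. (s, exp (2 * L * s) *\<^sub>R z s))"
      using that by (auto intro!: continuous_intros elim!: continuous_on_subset)
    from continuous_on_compose2[OF contF this] that show ?thesis
      unfolding G_def by fastforce
  qed
  have \<Phi>: "\<Phi> z \<in> bcontfun" if z: "continuous_on UNIV z" for z
  proof -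
    let ?h = "\<lambda>t. exp (- (2 * L * t)) *\<^sub>R (y0 + integral {0..t} (G z))"
    have h: "continuous_on {0..T} ?h"
      using contG[OF z] \<open>0 \<le> T\<close>
      by (intro continuous_intros indefinite_integral_continuous_1 integrable_continuous_real) auto
    have "continuous_on UNIV c"
      unfolding c_def by (intro continuous_intros)
    then have "continuous_on UNIV (\<Phi> z)"
      unfolding \<Phi>_def using continuous_on_compose2[OF h, of UNIV c] c
      by (simp add: image_subset_iff)
    moreover have "bounded (range (\<Phi> z))"
    proof (rule bounded_subset)
      show "bounded (?h ` {0..T})"
        using compact_continuous_image[OF h] by (intro compact_imp_bounded) auto
      show "range (\<Phi> z) \<subseteq> ?h ` {0..T}"
        using c by (auto simp: \<Phi>_def)
    qed
    ultimately show ?thesis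
      by (simp add: bcontfun_def)
  qed
  define \<Psi> where "\<Psi> z = Bcontfun (\<Phi> (apply_bcontfun z))" for z
  have \<Psi>: "apply_bcontfun (\<Psi> z) = \<Phi> (apply_bcontfun z)" for z
    unfolding \<Psi>_def by (rule Bcontfun_inverse) (simp add: \<Phi>)
  have "\<exists>!z. \<Psi> z = z"
  proof (rule banach_fix_type)
    show "\<forall>y z. dist (\<Psi> y) (\<Psi> z) \<le> 1 / 2 * dist y z"
    proof (intro allI dist_bound)
      fix y z t
      note cy = contG[of "apply_bcontfun y", OF _ c[of t], simplified]
      note cz = contG[of "apply_bcontfun z", OF _ c[of t], simplified]
      have eq: "\<Psi> y t - \<Psi> z t =
          exp (- (2 * L * c t)) *\<^sub>R integral {0..c t} (\<lambda>s. G y s - G z s)"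
        using cy cz
        by (simp add: \<Psi> \<Phi>_def integral_diff integrable_continuous_real scaleR_diff_right[symmetric])
      have "norm (integral {0..c t} (\<lambda>s. G y s - G z s)) \<le>
          (L * dist y z) / (2 * L) * exp (2 * L * c t)"
      proof (rule exp_integral_bound)
        show "continuous_on {0..c t} (\<lambda>s. G y s - G z s)"
          using cy cz by (intro continuous_intros)
        fix s assume "s \<in> {0..c t}"
        then have "s \<in> {0..T}"
          using c[of t] by auto
        from lip[OF this]
        have "norm (G y s - G z s) \<le> L * norm (exp (2 * L * s) *\<^sub>R y s - exp (2 * L * s) *\<^sub>R z s)"
          unfolding G_def .
        also have "\<dots> = L * (dist (y s) (z s) * exp (2 * L * s))"
          by (simp add: scaleR_diff_right[symmetric] dist_norm)
        also have "\<dots> \<le> L * (dist y z * exp (2 * L * s))"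
          using \<open>0 < L\<close> dist_bounded[of y s z] by simp
        finally show "norm (G y s - G z s) \<le> L * dist y z * exp (2 * L * s)" by simp
      qed (use c[of t] \<open>0 < L\<close> in auto)
      then have "norm (\<Psi> y t - \<Psi> z t) \<le> exp (- (2 * L * c t)) * (dist y z / 2 * exp (2 * L * c t))"
        unfolding eq using \<open>0 < L\<close> by simp
      also have "\<dots> = 1 / 2 * dist y z"
        by (simp add: exp_minus)
      finally show "dist (\<Psi> y t) (\<Psi> z t) \<le> 1 / 2 * dist y z"
        by (simp add: dist_norm)
    qed
  qed auto
  then obtain z where "\<Psi> z = z" by blast
  then have z_eq: "apply_bcontfun z = \<Phi> z"
    using \<Psi>[of z] by simp
  define y where "y t = exp (2 * L * t) *\<^sub>R z t" for t
  show thesis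
  proof
    show "continuous_on {0..T} y"
      unfolding y_def by (intro continuous_intros continuous_on_apply_bcontfun)
    fix t assume t: "t \<in> {0..T}"
    then have "c t = t" by (auto simp: c_def)
    have "y t = exp (2 * L * t) *\<^sub>R \<Phi> z t"
      by (simp add: y_def z_eq[symmetric])
    also have "\<dots> = y0 + integral {0..t} (G z)"
      by (simp add: \<Phi>_def \<open>c t = t\<close> exp_minus)
    finally show "y t = y0 + integral {0..t} (\<lambda>s. F s (y s))"
      by (simp add: G_def[abs_def] y_def)
  qed
qed

text \<open>If \<open>f t < 0\<close>, then \<open>f\<close> is nonpositive, hence nondecreasing, since the last time \<open>r\<close> with
  \<open>f r \<ge> 0\<close>, which contradicts \<open>f t < 0\<close>.\<close>
lemma nonneg_invariant:
  fixes f g :: "real \<Rightarrow> real"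
  assumes cont: "continuous_on {0..b} f"
    and deriv: "\<And>t. t \<in> {0..b} \<Longrightarrow> (f has_real_derivative g t) (at t within {0..b})"
    and inward: "\<And>t. t \<in> {0..b} \<Longrightarrow> f t \<le> 0 \<Longrightarrow> 0 \<le> g t"
    and "0 \<le> f 0" and t: "t \<in> {0..b}"
  shows "0 \<le> f t"
proof (rule ccontr)
  assume "\<not> 0 \<le> f t"
  have ct: "continuous_on {0..t} f"
    using cont t by (auto elim: continuous_on_subset)
  have "closed ({0..t} \<inter> f -` {0..})"
    using ct by (intro continuous_closed_preimage) auto
  then have "compact ({0..t} \<inter> f -` {0..})"
    by (simp add: compact_eq_bounded_closed bounded_Int)
  moreover have "0 \<in> {0..t} \<inter> f -` {0..}"
    using assms by auto
  ultimately obtain r where r: "r \<in> {0..t} \<inter> f -` {0..}"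
    and last: "\<And>s. s \<in> {0..t} \<inter> f -` {0..} \<Longrightarrow> s \<le> r"
    using compact_attains_sup[of "{0..t} \<inter> f -` {0..}"] by blast
  have "r < t" using r \<open>\<not> 0 \<le> f t\<close> by (cases "r = t") auto
  have neg: "f s \<le> 0" if "s \<in> {r<..<t}" for s
    using last[of s] that r by (cases "f s \<ge> 0") auto
  have "f r \<le> f t"
  proof (rule DERIV_nonneg_imp_increasing_open[of r t f])
    fix x assume x: "r < x" "x < t"
    then have "x \<in> {0..b}" "x \<in> interior {0..b}"
      using r t by (auto simp: interior_atLeastAtMost_real)
    then show "\<exists>y. DERIV f x :> y \<and> 0 \<le> y"
      using deriv[of x] inward[of x] neg[of x] x at_within_interior[of x "{0..b}"] by auto
  qed (use \<open>r < t\<close> r ct in \<open>auto elim: continuous_on_subset\<close>)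
  with r \<open>\<not> 0 \<le> f t\<close> show False by auto
qed

section \<open>Sobolev regularity of C1 functions\<close>

lemma continuous_imp_L_infinity:
  fixes f :: "real \<Rightarrow> real"
  assumes "continuous_on {a..b} f"
  shows "f \<in> L_infinity {a<..<b}"
proof -
  have "f \<in> borel_measurable (lebesgue_on {a<..<b})"
    using assms by (intro continuous_imp_measurable_on_sets_lebesgue)
      (auto elim: continuous_on_subset)
  moreover obtain C where "\<And>t. t \<in> {a..b} \<Longrightarrow> \<bar>f t\<bar> \<le> C"
    using compact_imp_bounded[OF compact_continuous_image[OF assms]]
    unfolding bounded_iff by force
  then have "AE t in lebesgue_on {a<..<b}. \<bar>f t\<bar> \<le> C"
    by (intro AE_I2) auto
  ultimately show ?thesis
    by (auto simp: L_infinity_def)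
qed

lemma lebesgue_integral_open_interval:
  fixes f :: "real \<Rightarrow> real"
  assumes "continuous_on {a..b} f"
  shows "(LINT t|lebesgue_on {a<..<b}. f t) = integral {a..b} f"
proof -
  have "set_integrable lebesgue {a<..<b} f"
    using absolutely_integrable_continuous_real[OF assms]
    by (rule set_integrable_subset) auto
  then have "integrable (lebesgue_on {a<..<b}) f"
    by (simp add: integrable_restrict_space set_integrable_def)
  then show ?thesis
    by (simp add: lebesgue_integral_eq_integral integral_open_interval_real)
qed

text \<open>Integration by parts: a test function vanishes at both ends of the interval, so the integral of
  the derivative of \<open>f \<phi>\<close> is \<open>0\<close>.\<close>
lemma C1_imp_W1_infinity:
  fixes f g :: "real \<Rightarrow> real"
  assumes "a < b" and g: "continuous_on {a..b} g"
    and deriv: "\<And>t. t \<in> {a..b} \<Longrightarrow> (f has_real_derivative g t) (at t within {a..b})"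
  shows "f \<in> W1_infinity a b"
proof -
  have f: "continuous_on {a..b} f"
    using deriv by (rule DERIV_continuous_on)
  have "weak_derivative a b f g"
    unfolding weak_derivative_def
  proof (intro allI impI)
    fix \<phi> assume \<phi>: "test_function a b \<phi>"
    then have diff: "(deriv ^^ n) \<phi> field_differentiable at t" for n t
      by (simp add: test_function_def)
    have d: "(\<phi> has_real_derivative deriv \<phi> t) (at t)" for t
      using diff[of 0 t] by (simp add: field_differentiable_derivI)
    have dd: "(deriv \<phi> has_real_derivative deriv (deriv \<phi>) t) (at t)" for t
      using diff[of 1 t] by (simp add: field_differentiable_derivI)
    have c: "continuous_on {a..b} \<phi>" "continuous_on {a..b} (deriv \<phi>)"
      using d dd by (meson DERIV_continuous_on has_field_derivative_at_within)+
    have "a \<notin> closure {t. \<phi> t \<noteq> 0}" "b \<notin> closure {t. \<phi> t \<noteq> 0}"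
      using \<phi> by (auto simp: test_function_def)
    then have end0: "\<phi> a = 0" "\<phi> b = 0"
      using closure_subset[of "{t. \<phi> t \<noteq> 0}"] by auto
    have "((\<lambda>t. f t * deriv \<phi> t + g t * \<phi> t) has_integral (f b * \<phi> b - f a * \<phi> a)) {a..b}"
    proof (intro fundamental_theorem_of_calculus)
      fix t assume "t \<in> {a..b}"
      then show "((\<lambda>t. f t * \<phi> t) has_vector_derivative (f t * deriv \<phi> t + g t * \<phi> t))
          (at t within {a..b})"
        using DERIV_mult[OF deriv has_field_derivative_at_within[OF d], of t]
        by (simp add: has_real_derivative_iff_has_vector_derivative[symmetric] add.commute mult.commute)
    qed (use \<open>a < b\<close> in auto)
    then have "integral {a..b} (\<lambda>t. f t * deriv \<phi> t + g t * \<phi> t) = 0"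
      by (simp add: end0 integral_unique)
    then have "integral {a..b} (\<lambda>t. f t * deriv \<phi> t) = - integral {a..b} (\<lambda>t. g t * \<phi> t)"
      using f g c by (subst (asm) integral_add)
        (auto intro!: integrable_continuous_real continuous_intros)
    then show "(LINT t|lebesgue_on {a<..<b}. f t * deriv \<phi> t) =
        - (LINT t|lebesgue_on {a<..<b}. g t * \<phi> t)"
      using f g c by (simp add: lebesgue_integral_open_interval continuous_intros)
  qed
  with f g show ?thesis
    by (auto simp: W1_infinity_def continuous_imp_L_infinity)
qed

lemma indefinite_integral_W1_infinity:
  fixes f g :: "real \<Rightarrow> real"
  assumes "0 \<le> a" "a < b" and g: "continuous_on {0..b} g"
    and f: "\<And>t. t \<in> {0..b} \<Longrightarrow> f t = f0 + integral {0..t} g"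
  shows "f \<in> W1_infinity a b"
proof (rule C1_imp_W1_infinity)
  show "continuous_on {a..b} g"
    using g \<open>0 \<le> a\<close> by (auto elim: continuous_on_subset)
  fix t assume t: "t \<in> {a..b}"
  have "((\<lambda>t. f0 + integral {0..t} g) has_real_derivative g t) (at t within {0..b})"
    using integral_has_real_derivative[OF g, of t] t \<open>0 \<le> a\<close>
    by (auto intro!: derivative_eq_intros)
  then have "((\<lambda>t. f0 + integral {0..t} g) has_real_derivative g t) (at t within {a..b})"
    by (rule DERIV_subset) (use \<open>0 \<le> a\<close> in auto)
  then show "(f has_real_derivative g t) (at t within {a..b})"
    by (rule has_field_derivative_transform_within[of _ _ _ _ 1]) (use t f \<open>0 \<le> a\<close> in auto)
qed (fact \<open>a < b\<close>)

section \<open>Lipschitz estimate for the acceleration\<close>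

lemma inverse_square_lipschitz:
  fixes g h :: real
  assumes "0 < \<epsilon>" "\<epsilon> \<le> g" "\<epsilon> \<le> h"
  shows "\<bar>1 / g\<^sup>2 - 1 / h\<^sup>2\<bar> \<le> 2 / \<epsilon> ^ 3 * \<bar>g - h\<bar>"
proof -
  have pos: "0 < g" "0 < h" using assms by auto
  have le: "1 / g \<le> 1 / \<epsilon>" "1 / h \<le> 1 / \<epsilon>"
    using assms pos by (auto simp: frac_le)
  have "1 / g\<^sup>2 - 1 / h\<^sup>2 = (h - g) * ((1 / g) * (1 / h) * (1 / g + 1 / h))"
    using pos by (simp add: field_simps power2_eq_square)
  then have "\<bar>1 / g\<^sup>2 - 1 / h\<^sup>2\<bar> = \<bar>g - h\<bar> * ((1 / g) * (1 / h) * (1 / g + 1 / h))"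
    using pos by (simp add: abs_mult abs_minus_commute)
  also have "\<dots> \<le> \<bar>g - h\<bar> * ((1 / \<epsilon>) * (1 / \<epsilon>) * (1 / \<epsilon> + 1 / \<epsilon>))"
    using le pos assms(1) by (intro mult_left_mono mult_mono add_mono) auto
  finally show ?thesis
    by (simp add: power3_eq_cube mult.commute)
qed

text \<open>Positions enter only through the gap, so a gap \<open>g\<close> is encoded as leader position \<open>g\<close> and
  follower position \<open>0\<close>.\<close>
lemma acceleration_gap:
  "acceleration kv kd k \<tau>s (xl - x) 0 vl v u = acceleration kv kd k \<tau>s xl x vl v u"
  by (simp add: acceleration_def)

lemma acceleration_lipschitz:
  assumes "0 \<le> kv" "0 \<le> kd" "0 \<le> k" "0 \<le> \<tau>s" "0 < \<epsilon>" "\<epsilon> \<le> g" "\<epsilon> \<le> h" "\<bar>vl - v\<bar> \<le> M"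
  shows "\<bar>acceleration kv kd k \<tau>s g 0 vl v u - acceleration kv kd k \<tau>s h 0 vl w u\<bar>
     \<le> (2 * kv * M / \<epsilon> ^ 3 + kd) * \<bar>g - h\<bar> + (kv / \<epsilon>\<^sup>2 + kd * \<tau>s + k) * \<bar>v - w\<bar>"
proof -
  have min_le: "\<bar>min a b - min c d\<bar> \<le> \<bar>a - c\<bar> + \<bar>b - d\<bar>" for a b c d :: real
    by (auto simp: min_def)
  have "\<bar>(vl - v) / g\<^sup>2 - (vl - w) / h\<^sup>2\<bar> = \<bar>(vl - v) * (1 / g\<^sup>2 - 1 / h\<^sup>2) + (w - v) * (1 / h\<^sup>2)\<bar>"
    by (simp add: diff_divide_distrib algebra_simps)
  also have "\<dots> \<le> \<bar>vl - v\<bar> * \<bar>1 / g\<^sup>2 - 1 / h\<^sup>2\<bar> + \<bar>w - v\<bar> * (1 / h\<^sup>2)"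
    using abs_triangle_ineq[of "(vl - v) * (1 / g\<^sup>2 - 1 / h\<^sup>2)" "(w - v) * (1 / h\<^sup>2)"]
    by (simp add: abs_mult)
  also have "\<dots> \<le> M * (2 / \<epsilon> ^ 3 * \<bar>g - h\<bar>) + \<bar>w - v\<bar> * (1 / \<epsilon>\<^sup>2)"
    using assms inverse_square_lipschitz[of \<epsilon> g h]
    by (intro add_mono mult_mono) (auto intro!: frac_le power_mono)
  finally have "kv * \<bar>(vl - v) / g\<^sup>2 - (vl - w) / h\<^sup>2\<bar>
      \<le> kv * (M * (2 / \<epsilon> ^ 3 * \<bar>g - h\<bar>) + \<bar>w - v\<bar> * (1 / \<epsilon>\<^sup>2))"
    using assms(1) by (rule mult_left_mono)
  then have 1: "\<bar>kv * ((vl - v) / g\<^sup>2) - kv * ((vl - w) / h\<^sup>2)\<bar>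
      \<le> 2 * kv * M / \<epsilon> ^ 3 * \<bar>g - h\<bar> + kv / \<epsilon>\<^sup>2 * \<bar>v - w\<bar>"
    unfolding right_diff_distrib[symmetric] abs_mult abs_of_nonneg[OF assms(1)]
    by (simp add: abs_minus_commute[of w v] distrib_left mult_ac)
  have "kd * (g - \<tau>s * v) - kd * (h - \<tau>s * w) = kd * (g - h) + (kd * \<tau>s) * (w - v)"
    by (simp add: algebra_simps)
  then have 2: "\<bar>kd * (g - \<tau>s * v) - kd * (h - \<tau>s * w)\<bar> \<le> kd * \<bar>g - h\<bar> + kd * \<tau>s * \<bar>v - w\<bar>"
    using abs_triangle_ineq[of "kd * (g - h)" "(kd * \<tau>s) * (w - v)"] assms
    by (simp add: abs_mult abs_minus_commute)
  have 3: "\<bar>k * (u - v) - k * (u - w)\<bar> = k * \<bar>v - w\<bar>"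
    using assms(3) by (simp add: right_diff_distrib[symmetric] abs_mult abs_minus_commute)
  have "\<bar>acceleration kv kd k \<tau>s g 0 vl v u - acceleration kv kd k \<tau>s h 0 vl w u\<bar>
      \<le> \<bar>kv * ((vl - v) / g\<^sup>2) - kv * ((vl - w) / h\<^sup>2)\<bar>
        + \<bar>kd * (g - \<tau>s * v) - kd * (h - \<tau>s * w)\<bar> + \<bar>k * (u - v) - k * (u - w)\<bar>"
    unfolding acceleration_def
    using abs_triangle_ineq[of "kv * ((vl - v) / g\<^sup>2) - kv * ((vl - w) / h\<^sup>2)"
        "kd * (g - \<tau>s * v) - kd * (h - \<tau>s * w)"]
    by (intro order_trans[OF min_le]) (simp add: add_diff_add)
  with 1 2 3 show ?thesis
    by (simp add: algebra_simps)
qed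

section \<open>The floored system\<close>

locale car_following =
  fixes kv kd k \<tau>s umin umax vmax T :: real
    and u al :: "real \<Rightarrow> real"
    and xl0 x0 vl0 v0 :: real
  assumes pos: "0 < kv" "0 < kd" "0 < k" "0 < \<tau>s" "0 < T"
    and bounds: "0 < umin" "umax < vmax"
    and u_cont: "continuous_on {0..T} u"
    and u_range: "\<And>t. t \<in> {0..T} \<Longrightarrow> u t \<in> {umin..umax}"
    and al_cont: "continuous_on {0..T} al"
    and leader_range: "\<And>t. t \<in> {0..T} \<Longrightarrow> vl0 + integral {0..t} al \<in> {0..vmax}"
    and init: "(xl0, x0, vl0, v0) \<in> state_space vmax"
begin

definition VL :: "real \<Rightarrow> real" where
  "VL t = vl0 + integral {0..t} al"

definition XL :: "real \<Rightarrow> real" where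
  "XL t = xl0 + integral {0..t} VL"

abbreviation sol where
  "sol \<equiv> solution kv kd k \<tau>s vmax T u al xl0 x0 vl0 v0"

text \<open>The gap is kept at or above \<open>\<epsilon>\<close> and the speed in \<open>[0, vmax]\<close>; this removes the singularity at
  collision and bounds the factor \<open>vl - v\<close> in front of it, and so makes the right-hand side
  globally Lipschitz.\<close>
definition floored_acceleration :: "real \<Rightarrow> real \<Rightarrow> real \<Rightarrow> real \<Rightarrow> real" where
  "floored_acceleration \<epsilon> t x v =
     acceleration kv kd k \<tau>s (max \<epsilon> (XL t - x)) 0 (VL t) (max 0 (min vmax v)) (u t)"

definition floored_solution :: "real \<Rightarrow> real \<Rightarrow> (real \<Rightarrow> real) \<Rightarrow> (real \<Rightarrow> real) \<Rightarrow> bool" where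
  "floored_solution \<epsilon> b x v \<longleftrightarrow>
     continuous_on {0..b} x \<and> continuous_on {0..b} v \<and>
     (\<forall>t\<in>{0..b}. x t = x0 + integral {0..t} v \<and>
        v t = v0 + integral {0..t} (\<lambda>s. floored_acceleration \<epsilon> s (x s) (v s)))"

lemma VL_cont: "continuous_on {0..T} VL"
  unfolding VL_def[abs_def]
  by (intro continuous_intros indefinite_integral_continuous_1 integrable_continuous_real al_cont)

lemma XL_cont: "continuous_on {0..T} XL"
  unfolding XL_def[abs_def]
  by (intro continuous_intros indefinite_integral_continuous_1 integrable_continuous_real VL_cont)

lemma VL_range: "t \<in> {0..T} \<Longrightarrow> VL t \<in> {0..vmax}"
  using leader_range by (simp add: VL_def)

lemma vmax_pos: "0 < vmax"
  using bounds u_range[of 0] pos by auto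

lemma continuous_floored_acceleration:
  assumes "0 < \<epsilon>" "b \<le> T"
    and "continuous_on S f" "continuous_on S x" "continuous_on S v" "f ` S \<subseteq> {0..b}"
  shows "continuous_on S (\<lambda>p. floored_acceleration \<epsilon> (f p) (x p) (v p))"
proof -
  have f: "f ` S \<subseteq> {0..T}"
    using assms by auto
  have "max \<epsilon> h \<noteq> 0" for h
    using assms(1) by auto
  then show ?thesis
    unfolding floored_acceleration_def acceleration_def using assms
    by (intro continuous_intros continuous_on_compose2[OF VL_cont _ f]
        continuous_on_compose2[OF XL_cont _ f] continuous_on_compose2[OF u_cont _ f]) auto
qed

lemma floored_acceleration_lipschitz:
  assumes "0 < \<epsilon>"
  obtains L where "0 < L"
    "\<And>t x v y w. t \<in> {0..T} \<Longrightarrow>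
       \<bar>floored_acceleration \<epsilon> t x v - floored_acceleration \<epsilon> t y w\<bar> \<le> L * (\<bar>x - y\<bar> + \<bar>v - w\<bar>)"
proof
  let ?A = "2 * kv * vmax / \<epsilon> ^ 3 + kd" and ?B = "kv / \<epsilon>\<^sup>2 + kd * \<tau>s + k"
  have nn: "0 < ?A" "0 < ?B"
    using pos vmax_pos assms by (auto intro!: add_nonneg_pos divide_nonneg_pos)
  then show "0 < ?A + ?B" by simp
  fix t x v y w assume t: "t \<in> {0..T}"
  let ?g = "max \<epsilon> (XL t - x)" and ?h = "max \<epsilon> (XL t - y)"
  let ?v = "max 0 (min vmax v)" and ?w = "max 0 (min vmax w)"
  have "\<bar>floored_acceleration \<epsilon> t x v - floored_acceleration \<epsilon> t y w\<bar>
      \<le> ?A * \<bar>?g - ?h\<bar> + ?B * \<bar>?v - ?w\<bar>"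
    unfolding floored_acceleration_def
    using VL_range[OF t] vmax_pos assms pos by (intro acceleration_lipschitz) auto
  also have "\<dots> \<le> ?A * \<bar>x - y\<bar> + ?B * \<bar>v - w\<bar>"
    using nn by (intro add_mono mult_left_mono) (auto simp: max_def min_def)
  also have "\<dots> \<le> (?A + ?B) * \<bar>x - y\<bar> + (?A + ?B) * \<bar>v - w\<bar>"
    by (rule add_mono[OF mult_right_mono mult_right_mono]) (use nn in linarith)+
  finally show "\<bar>floored_acceleration \<epsilon> t x v - floored_acceleration \<epsilon> t y w\<bar>
      \<le> (?A + ?B) * (\<bar>x - y\<bar> + \<bar>v - w\<bar>)"
    by (simp add: distrib_left)
qed

definition floored_field :: "real \<Rightarrow> real \<Rightarrow> real \<times> real \<Rightarrow> real \<times> real" where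
  "floored_field \<epsilon> t p = (snd p, floored_acceleration \<epsilon> t (fst p) (snd p))"

lemma floored_field_continuous:
  assumes "0 < \<epsilon>" "b \<le> T"
  shows "continuous_on ({0..b} \<times> UNIV) (\<lambda>(t, p). floored_field \<epsilon> t p)"
  unfolding floored_field_def case_prod_unfold using assms
  by (intro continuous_intros continuous_floored_acceleration[where b = b]) auto

lemma floored_field_lipschitz:
  assumes "0 < \<epsilon>"
  obtains L where "0 < L"
    "\<And>t p q. t \<in> {0..T} \<Longrightarrow> norm (floored_field \<epsilon> t p - floored_field \<epsilon> t q) \<le> L * norm (p - q)"
proof -
  obtain L where "0 < L" and L: "\<And>t x v y w. t \<in> {0..T} \<Longrightarrow>
       \<bar>floored_acceleration \<epsilon> t x v - floored_acceleration \<epsilon> t y w\<bar> \<le> L * (\<bar>x - y\<bar> + \<bar>v - w\<bar>)"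
    using floored_acceleration_lipschitz[OF assms] by blast
  show thesis
  proof
    show "0 < 1 + 2 * L" using \<open>0 < L\<close> by simp
    fix t p q assume t: "t \<in> {0..T}"
    have le: "\<bar>fst p - fst q\<bar> \<le> norm (p - q)" "\<bar>snd p - snd q\<bar> \<le> norm (p - q)"
      using norm_fst_le[of "fst p - fst q" "snd p - snd q"]
        norm_snd_le[of "snd p - snd q" "fst p - fst q"] by (simp_all add: minus_prod_def)
    have "norm (floored_field \<epsilon> t p - floored_field \<epsilon> t q) \<le> \<bar>snd p - snd q\<bar> +
        \<bar>floored_acceleration \<epsilon> t (fst p) (snd p) - floored_acceleration \<epsilon> t (fst q) (snd q)\<bar>"
      unfolding floored_field_def using norm_Pair_le by (metis diff_Pair real_norm_def)
    also have "\<dots> \<le> norm (p - q) + L * (norm (p - q) + norm (p - q))"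
      using le \<open>0 < L\<close> by (intro add_mono order_trans[OF L[OF t]] mult_left_mono) auto
    finally show "norm (floored_field \<epsilon> t p - floored_field \<epsilon> t q) \<le> (1 + 2 * L) * norm (p - q)"
      by (simp add: algebra_simps)
  qed
qed

lemma integral_floored_field:
  assumes "0 < \<epsilon>" "b \<le> T" "continuous_on {0..b} x" "continuous_on {0..b} v" "t \<in> {0..b}"
  shows "integral {0..t} (\<lambda>s. floored_field \<epsilon> s (x s, v s)) =
    (integral {0..t} v, integral {0..t} (\<lambda>s. floored_acceleration \<epsilon> s (x s) (v s)))"
proof -
  have "(\<lambda>s. floored_field \<epsilon> s (x s, v s)) integrable_on {0..t}"
    unfolding floored_field_def using assms
    by (intro integrable_continuous_real continuous_intros
        continuous_floored_acceleration[where b = b])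
      (auto elim: continuous_on_subset)
  from integral_linear[OF this bounded_linear_fst] integral_linear[OF this bounded_linear_snd]
  show ?thesis
    by (simp add: floored_field_def o_def prod_eq_iff)
qed

lemma floored_solution_exists:
  assumes "0 < \<epsilon>"
  obtains x v where "floored_solution \<epsilon> T x v"
proof -
  obtain L where L: "0 < L" "\<And>t p q. t \<in> {0..T} \<Longrightarrow>
      norm (floored_field \<epsilon> t p - floored_field \<epsilon> t q) \<le> L * norm (p - q)"
    using floored_field_lipschitz[OF assms] by blast
  obtain y where y: "continuous_on {0..T} y"
    "\<And>t. t \<in> {0..T} \<Longrightarrow> y t = (x0, v0) + integral {0..t} (\<lambda>s. floored_field \<epsilon> s (y s))"
    using integral_equation_exists[OF _ L(1) floored_field_continuous[OF assms order_refl] L(2)] pos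
    by (metis less_imp_le)
  have c: "continuous_on {0..T} (\<lambda>t. fst (y t))" "continuous_on {0..T} (\<lambda>t. snd (y t))"
    using y(1) by (auto intro: continuous_intros)
  show thesis
  proof
    show "floored_solution \<epsilon> T (\<lambda>t. fst (y t)) (\<lambda>t. snd (y t))"
      unfolding floored_solution_def
    proof (intro conjI ballI c)
      fix t assume t: "t \<in> {0..T}"
      have "y t = (x0, v0) + (integral {0..t} (\<lambda>t. snd (y t)),
          integral {0..t} (\<lambda>s. floored_acceleration \<epsilon> s (fst (y s)) (snd (y s))))"
        using y(2)[OF t] integral_floored_field[OF assms order_refl c t] by simp
      then show "fst (y t) = x0 + integral {0..t} (\<lambda>t. snd (y t))"
        "snd (y t) = v0 + integral {0..t} (\<lambda>s. floored_acceleration \<epsilon> s (fst (y s)) (snd (y s)))"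
        by (simp_all add: prod_eq_iff)
    qed
  qed
qed

lemma floored_solution_unique:
  assumes "0 < \<epsilon>" "b \<le> T" "floored_solution \<epsilon> b x v" "floored_solution \<epsilon> b x' v'" "t \<in> {0..b}"
  shows "x t = x' t" "v t = v' t"
proof -
  obtain L where L: "0 < L" "\<And>t p q. t \<in> {0..T} \<Longrightarrow>
      norm (floored_field \<epsilon> t p - floored_field \<epsilon> t q) \<le> L * norm (p - q)"
    using floored_field_lipschitz[OF \<open>0 < \<epsilon>\<close>] by blast
  have *: "continuous_on {0..b} (\<lambda>t. (x t, v t))"
    "s \<in> {0..b} \<Longrightarrow> (x s, v s) = (x0, v0) + integral {0..s} (\<lambda>r. floored_field \<epsilon> r (x r, v r))"
    if "floored_solution \<epsilon> b x v" for x v s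
    using that integral_floored_field[OF assms(1,2), of x v s]
    by (auto simp: floored_solution_def intro: continuous_intros)
  have "(x t, v t) = (x' t, v' t)"
    by (rule integral_equation_unique[OF _ L(1) floored_field_continuous[OF assms(1,2)],
          where y = "\<lambda>t. (x t, v t)" and z = "\<lambda>t. (x' t, v' t)" and ?y0.0 = "(x0, v0)"])
      (use assms L(2) *[OF assms(3)] *[OF assms(4)] in auto)
  then show "x t = x' t" "v t = v' t" by auto
qed

text \<open>The two ends of \<open>[0, vmax]\<close> repel: at projected speed \<open>0\<close> the interaction term is nonnegative
  and the free-flow term is \<open>k u > 0\<close>, while at projected speed \<open>vmax\<close> the free-flow term is
  \<open>k (u - vmax) < 0\<close>.\<close>
lemma floored_solution_velocity:
  assumes "0 < \<epsilon>" "b \<le> T" and fs: "floored_solution \<epsilon> b x v" and t: "t \<in> {0..b}"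
  shows "v t \<in> {0..vmax}"
proof -
  let ?g = "\<lambda>s. floored_acceleration \<epsilon> s (x s) (v s)"
  have c: "continuous_on {0..b} x" "continuous_on {0..b} v"
    and v: "\<And>t. t \<in> {0..b} \<Longrightarrow> v t = v0 + integral {0..t} ?g"
    using fs by (auto simp: floored_solution_def)
  have g: "continuous_on {0..b} ?g"
    using assms(1,2) c by (intro continuous_floored_acceleration[where b = b]) auto
  have D: "(v has_real_derivative ?g t) (at t within {0..b})" if "t \<in> {0..b}" for t
  proof (rule has_field_derivative_transform_within[of _ _ _ _ 1])
    show "((\<lambda>t. v0 + integral {0..t} ?g) has_real_derivative ?g t) (at t within {0..b})"
      using integral_has_real_derivative[OF g that] by (auto intro!: derivative_eq_intros)
  qed (use v that in auto)
  have "v 0 = v0" using v[of 0] t by simp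
  then have v_init: "v 0 \<in> {0..vmax}" using init by (simp add: state_space_def)
  have "0 \<le> v t"
  proof (rule nonneg_invariant[where f = v and g = ?g and b = b, OF c(2) D])
    fix t assume "t \<in> {0..b}" "v t \<le> 0"
    with assms have t: "t \<in> {0..T}" by auto
    have "max 0 (min vmax (v t)) = 0" using \<open>v t \<le> 0\<close> vmax_pos by auto
    then show "0 \<le> ?g t"
      using VL_range[OF t] u_range[OF t] bounds pos assms(1)
      by (simp add: floored_acceleration_def acceleration_def)
  qed (use v_init t in auto)
  moreover have "0 \<le> vmax - v t"
  proof (rule nonneg_invariant[where f = "\<lambda>t. vmax - v t" and g = "\<lambda>t. - ?g t" and b = b])
    show "continuous_on {0..b} (\<lambda>t. vmax - v t)"
      using c by (intro continuous_intros)
    show "((\<lambda>t. vmax - v t) has_real_derivative - ?g t) (at t within {0..b})" if "t \<in> {0..b}" for t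
      using D[OF that] by (auto intro!: derivative_eq_intros)
    fix t assume "t \<in> {0..b}" "vmax - v t \<le> 0"
    with assms have t: "t \<in> {0..T}" by auto
    have "max 0 (min vmax (v t)) = vmax" using \<open>vmax - v t \<le> 0\<close> vmax_pos by auto
    moreover have "k * (u t - vmax) \<le> 0"
      using u_range[OF t] bounds pos by (simp add: mult_le_0_iff)
    ultimately show "0 \<le> - ?g t"
      by (simp add: floored_acceleration_def acceleration_def min_le_iff_disj)
  qed (use v_init t in auto)
  ultimately show ?thesis by simp
qed

section \<open>Solutions of the original system\<close>

lemma sol_leader:
  assumes "sol J xl x vl v" "t \<in> J"
  shows "vl t = VL t" "xl t = XL t"
proof -
  have J: "{0..t} \<subseteq> J"
    using assms mem_is_interval_1_I[of J 0 t] by (auto simp: solution_def)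
  have vl: "vl s = VL s" if "s \<in> J" for s
    using assms(1) that by (simp add: solution_def VL_def)
  show "vl t = VL t" using vl assms by simp
  have "integral {0..t} vl = integral {0..t} VL"
    using J vl by (intro integral_cong) auto
  then show "xl t = XL t"
    using assms by (simp add: solution_def XL_def)
qed

text \<open>The regularity required of a solution is automatic: each component is the integral of a
  continuous function, hence continuously differentiable.\<close>
lemma solutionI:
  assumes J: "is_interval J" "0 \<in> J" "J \<subseteq> {0..T}"
    and cont: "continuous_on J x" "continuous_on J v"
    and range: "\<And>t. t \<in> J \<Longrightarrow> x t < XL t" "\<And>t. t \<in> J \<Longrightarrow> v t \<in> {0..vmax}"
    and eq: "\<And>t. t \<in> J \<Longrightarrow> x t = x0 + integral {0..t} v"
      "\<And>t. t \<in> J \<Longrightarrow> v t = v0 + integral {0..t}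
         (\<lambda>s. acceleration kv kd k \<tau>s (XL s) (x s) (VL s) (v s) (u s))"
  shows "sol J XL x VL v"
proof -
  let ?a = "\<lambda>s. acceleration kv kd k \<tau>s (XL s) (x s) (VL s) (v s) (u s)"
  have W: "{XL, x, VL, v} \<subseteq> W1_infinity a b" if "a < b" "{a..b} \<subseteq> J" for a b
  proof -
    have "a \<in> J" "b \<in> J"
      using that by auto
    then have ab: "0 \<le> a" "b \<le> T" "b \<in> J"
      using J(3) by auto
    have sub: "{0..b} \<subseteq> J"
      using mem_is_interval_1_I[OF J(1,2) ab(3)] by auto
    have T: "{0..b} \<subseteq> {0..T}" using ab by auto
    note c = continuous_on_subset[OF cont(1) sub] continuous_on_subset[OF cont(2) sub]
      continuous_on_subset[OF XL_cont T] continuous_on_subset[OF VL_cont T]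
      continuous_on_subset[OF u_cont T] continuous_on_subset[OF al_cont T]
    have "\<forall>s\<in>{0..b}. (XL s - x s)\<^sup>2 \<noteq> 0"
      using range(1) sub by force
    then have a: "continuous_on {0..b} ?a"
      unfolding acceleration_def by (intro continuous_intros c)
    note W = indefinite_integral_W1_infinity[OF ab(1) that(1)]
    have "XL \<in> W1_infinity a b" by (rule W[OF c(4) XL_def])
    moreover have "VL \<in> W1_infinity a b" by (rule W[OF c(6) VL_def])
    moreover have "x \<in> W1_infinity a b" by (rule W[OF c(2) eq(1)[OF subsetD[OF sub]]])
    moreover have "v \<in> W1_infinity a b" by (rule W[OF a eq(2)[OF subsetD[OF sub]]])
    ultimately show ?thesis by simp
  qed
  have W': "\<forall>a b. a < b \<and> {a..b} \<subseteq> J \<longrightarrow> {XL, x, VL, v} \<subseteq> W1_infinity a b"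
    using W by blast
  have c: "continuous_on J (\<lambda>t. (XL t, x t, VL t, v t))"
    by (intro continuous_intros cont continuous_on_subset[OF XL_cont J(3)]
        continuous_on_subset[OF VL_cont J(3)])
  have S: "\<forall>t\<in>J. (XL t, x t, VL t, v t) \<in> state_space vmax"
  proof
    fix t assume t: "t \<in> J"
    then have "t \<in> {0..T}" using J(3) by blast
    from VL_range[OF this] range[OF t] show "(XL t, x t, VL t, v t) \<in> state_space vmax"
      by (simp add: state_space_def)
  qed
  have "\<forall>t\<in>J. XL t = xl0 + integral {0..t} VL \<and> VL t = vl0 + integral {0..t} al \<and>
      x t = x0 + integral {0..t} v \<and> v t = v0 + integral {0..t} ?a"
    by (intro ballI conjI XL_def VL_def eq)
  then show ?thesis
    unfolding solution_def by (intro conjI J c S W')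
qed

lemma solD:
  assumes "sol J xl x vl v"
  shows "is_interval J" "0 \<in> J" "J \<subseteq> {0..T}" "continuous_on J x" "continuous_on J v"
    and "t \<in> J \<Longrightarrow> x t < XL t" "t \<in> J \<Longrightarrow> v t \<in> {0..vmax}"
    and "t \<in> J \<Longrightarrow> x t = x0 + integral {0..t} v"
    and "t \<in> J \<Longrightarrow> v t = v0 + integral {0..t}
         (\<lambda>s. acceleration kv kd k \<tau>s (XL s) (x s) (VL s) (v s) (u s))"
proof -
  show J: "is_interval J" "0 \<in> J" "J \<subseteq> {0..T}"
    using assms unfolding solution_def by blast+
  have c: "continuous_on J (\<lambda>t. (xl t, x t, vl t, v t))"
    using assms unfolding solution_def by blast
  show "continuous_on J x" "continuous_on J v"
    using continuous_on_fst[OF continuous_on_snd[OF c]]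
      continuous_on_snd[OF continuous_on_snd[OF continuous_on_snd[OF c]]] by simp_all
  assume t: "t \<in> J"
  then have sub: "{0..t} \<subseteq> J"
    using mem_is_interval_1_I[OF J(1,2) t] by auto
  have "(xl t, x t, vl t, v t) \<in> state_space vmax"
    using assms t unfolding solution_def by blast
  then show "x t < XL t" "v t \<in> {0..vmax}"
    using sol_leader[OF assms t] by (auto simp: state_space_def)
  show "x t = x0 + integral {0..t} v"
    using assms t unfolding solution_def by blast
  have "v t = v0 + integral {0..t} (\<lambda>s. acceleration kv kd k \<tau>s (xl s) (x s) (vl s) (v s) (u s))"
    using assms t unfolding solution_def by blast
  also have "\<dots> = v0 + integral {0..t} (\<lambda>s. acceleration kv kd k \<tau>s (XL s) (x s) (VL s) (v s) (u s))"
    using sol_leader[OF assms] sub by (intro arg_cong2[where f = "(+)"] integral_cong) auto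
  finally show "v t = v0 + integral {0..t}
      (\<lambda>s. acceleration kv kd k \<tau>s (XL s) (x s) (VL s) (v s) (u s))" .
qed

lemma sol_restrict:
  assumes s: "sol J xl x vl v" and J': "is_interval J'" "0 \<in> J'" "J' \<subseteq> J"
  shows "sol J' XL x VL v"
proof (rule solutionI[OF J'(1,2)])
  note D = solD[OF s]
  show "J' \<subseteq> {0..T}" using D(3) J'(3) by blast
  show "continuous_on J' x" "continuous_on J' v"
    using D(4,5) J'(3) by (blast intro: continuous_on_subset)+
  fix t assume "t \<in> J'"
  then have "t \<in> J" using J'(3) by blast
  from D(6-9)[OF this] show "x t < XL t" "v t \<in> {0..vmax}" "x t = x0 + integral {0..t} v"
    "v t = v0 + integral {0..t} (\<lambda>s. acceleration kv kd k \<tau>s (XL s) (x s) (VL s) (v s) (u s))" .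
qed

lemma floored_acceleration_eq:
  assumes "\<epsilon> \<le> XL t - x" "v \<in> {0..vmax}"
  shows "floored_acceleration \<epsilon> t x v = acceleration kv kd k \<tau>s (XL t) x (VL t) v (u t)"
  using assms acceleration_gap[of kv kd k \<tau>s "XL t" x]
  by (simp add: floored_acceleration_def max_absorb2 min_absorb2)

lemma sol_imp_floored_solution:
  assumes s: "sol J xl x vl v" and "{0..b} \<subseteq> J"
    and gap: "\<And>t. t \<in> {0..b} \<Longrightarrow> \<epsilon> \<le> XL t - x t"
  shows "floored_solution \<epsilon> b x v"
  unfolding floored_solution_def
proof (intro conjI ballI)
  note D = solD[OF s]
  show "continuous_on {0..b} x" "continuous_on {0..b} v"
    using D(4,5) assms(2) by (auto elim: continuous_on_subset)
  fix t assume t: "t \<in> {0..b}"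
  then have J: "t \<in> J" using assms(2) by auto
  show "x t = x0 + integral {0..t} v" using D(8) J by blast
  have "integral {0..t} (\<lambda>s. floored_acceleration \<epsilon> s (x s) (v s)) =
      integral {0..t} (\<lambda>s. acceleration kv kd k \<tau>s (XL s) (x s) (VL s) (v s) (u s))"
  proof (rule integral_cong)
    fix s assume "s \<in> {0..t}"
    then have "s \<in> {0..b}" "s \<in> J" using t assms(2) by auto
    then show "floored_acceleration \<epsilon> s (x s) (v s) =
        acceleration kv kd k \<tau>s (XL s) (x s) (VL s) (v s) (u s)"
      using gap D(7) by (intro floored_acceleration_eq) blast+
  qed
  then show "v t = v0 + integral {0..t} (\<lambda>s. floored_acceleration \<epsilon> s (x s) (v s))"
    using D(9)[OF J] by simp
qed

lemma floored_solution_imp_sol: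
  assumes "0 < \<epsilon>" "b \<le> T" "floored_solution \<epsilon> T x v" "0 \<le> b"
    and gap: "\<And>t. t \<in> {0..b} \<Longrightarrow> \<epsilon> \<le> XL t - x t"
  shows "sol {0..b} XL x VL v"
proof (rule solutionI)
  have v: "v t \<in> {0..vmax}" if "t \<in> {0..b}" for t
    using floored_solution_velocity[OF assms(1) order_refl assms(3)] that assms(2) by auto
  have c: "continuous_on {0..T} x" "continuous_on {0..T} v"
    using assms(3) by (simp_all add: floored_solution_def)
  show "continuous_on {0..b} x" "continuous_on {0..b} v"
    using c assms(2) by (auto elim: continuous_on_subset)
  fix t assume t: "t \<in> {0..b}"
  show "x t < XL t" using gap[OF t] assms(1) by simp
  show "v t \<in> {0..vmax}" using v t .
  show "x t = x0 + integral {0..t} v"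
    using assms t by (simp add: floored_solution_def)
  have "integral {0..t} (\<lambda>s. floored_acceleration \<epsilon> s (x s) (v s)) =
      integral {0..t} (\<lambda>s. acceleration kv kd k \<tau>s (XL s) (x s) (VL s) (v s) (u s))"
    using v gap t by (intro integral_cong floored_acceleration_eq) auto
  then show "v t = v0 + integral {0..t}
      (\<lambda>s. acceleration kv kd k \<tau>s (XL s) (x s) (VL s) (v s) (u s))"
    using assms t by (simp add: floored_solution_def)
qed (use assms in \<open>auto simp: is_interval_cc\<close>)

lemma sol_gap_bound:
  assumes s: "sol J xl x vl v" and "{0..b} \<subseteq> J"
  obtains \<epsilon> where "0 < \<epsilon>" "\<And>t. t \<in> {0..b} \<Longrightarrow> \<epsilon> \<le> XL t - x t"
proof (cases "0 \<le> b")
  case True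
  have "{0..b} \<subseteq> {0..T}" using assms(2) solD(3)[OF s] by blast
  then have "continuous_on {0..b} (\<lambda>t. XL t - x t)"
    by (intro continuous_intros continuous_on_subset[OF XL_cont]
        continuous_on_subset[OF solD(4)[OF s] assms(2)])
  then obtain m where "m \<in> {0..b}" "\<And>t. t \<in> {0..b} \<Longrightarrow> XL m - x m \<le> XL t - x t"
    using continuous_attains_inf[of "{0..b}" "\<lambda>t. XL t - x t"] True by auto
  moreover have "0 < XL m - x m"
    using solD(6)[OF s, of m] \<open>m \<in> {0..b}\<close> assms(2) by auto
  ultimately show thesis using that by blast
next
  case False
  then show thesis using that[of 1] by auto
qed

text \<open>Both solutions have a positive minimal gap on \<open>[0, t]\<close>; both solve the system
  floored at the smaller of the two.\<close>
lemma sol_unique: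
  assumes s: "sol J xl x vl v" and s': "sol J' xl' x' vl' v'" and t: "t \<in> J" "t \<in> J'"
  shows "x t = x' t" "v t = v' t"
proof -
  note D = solD[OF s] and D' = solD[OF s']
  have sub: "{0..t} \<subseteq> J" "{0..t} \<subseteq> J'"
    using mem_is_interval_1_I[OF D(1,2) t(1)] mem_is_interval_1_I[OF D'(1,2) t(2)] by auto
  have tT: "0 \<le> t" "t \<le> T" using t D(3) by auto
  obtain \<epsilon> where \<epsilon>: "0 < \<epsilon>" "\<And>r. r \<in> {0..t} \<Longrightarrow> \<epsilon> \<le> XL r - x r"
    using sol_gap_bound[OF s sub(1)] by blast
  obtain \<delta> where \<delta>: "0 < \<delta>" "\<And>r. r \<in> {0..t} \<Longrightarrow> \<delta> \<le> XL r - x' r"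
    using sol_gap_bound[OF s' sub(2)] by blast
  have "floored_solution (min \<epsilon> \<delta>) t x v"
    using \<epsilon>(2) by (intro sol_imp_floored_solution[OF s sub(1)] min.coboundedI1)
  moreover have "floored_solution (min \<epsilon> \<delta>) t x' v'"
    using \<delta>(2) by (intro sol_imp_floored_solution[OF s' sub(2)] min.coboundedI2)
  moreover have "0 < min \<epsilon> \<delta>" using \<epsilon> \<delta> by simp
  ultimately show "x t = x' t" "v t = v' t"
    using floored_solution_unique[of "min \<epsilon> \<delta>" t x v x' v' t] tT by auto
qed

lemma sol_imp_unique_solution:
  assumes s: "sol J xl x vl v"
  shows "unique_solution kv kd k \<tau>s vmax T u al xl0 x0 vl0 v0 J xl x vl v"
  unfolding unique_solution_def
proof (intro conjI allI impI ballI)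
  fix xl' x' vl' v' t assume s': "sol J xl' x' vl' v'" and t: "t \<in> J"
  show "xl' t = xl t" "vl' t = vl t"
    using sol_leader[OF s t] sol_leader[OF s' t] by simp_all
  show "x' t = x t" "v' t = v t"
    using sol_unique[OF s' s t t] .
qed (fact s)

section \<open>Continuation up to the collision\<close>

text \<open>The interval \<open>J\<close> may be open or closed at \<open>b\<close>: continuity of the floored solution carries the
  bound on the gap over to \<open>b\<close>, and from there beyond \<open>b\<close> with \<open>m / 2\<close> in place of \<open>m\<close>.\<close>
lemma sol_extend:
  assumes s: "sol J xl x vl v" and J: "{0..<b} \<subseteq> J" "J \<subseteq> {0..b}" and "b \<le> T"
    and "0 < m" and gap: "\<And>t. t \<in> J \<Longrightarrow> m \<le> XL t - x t"
  obtains c y w where "c = T \<or> b < c \<and> c < T" "sol {0..c} XL y VL w"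
proof -
  note D = solD[OF s]
  have "0 \<le> b" using D(2) J by auto
  define \<epsilon> where "\<epsilon> = m / 2"
  have \<epsilon>: "0 < \<epsilon>" "\<epsilon> < m" using \<open>0 < m\<close> by (auto simp: \<epsilon>_def)
  obtain y w where yw: "floored_solution \<epsilon> T y w"
    using floored_solution_exists[OF \<epsilon>(1)] by blast
  have eq: "y t = x t" if "t \<in> J" for t
  proof (rule floored_solution_unique(1)
      [OF \<epsilon>(1), where b = t and x = y and v = w and x' = x and v' = v and t = t])
    show "t \<le> T" using that D(3) by auto
    then show "floored_solution \<epsilon> t y w"
      using yw by (auto simp: floored_solution_def elim: continuous_on_subset)
    have sub: "{0..t} \<subseteq> J" using mem_is_interval_1_I[OF D(1,2) that] by auto
    show "floored_solution \<epsilon> t x v"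
    proof (rule sol_imp_floored_solution[OF s sub])
      fix r assume "r \<in> {0..t}"
      then show "\<epsilon> \<le> XL r - x r" using gap[of r] sub \<epsilon> by force
    qed
    show "t \<in> {0..t}" using that D(3) by auto
  qed
  have cont: "continuous_on {0..T} (\<lambda>t. XL t - y t)"
    using yw XL_cont by (intro continuous_intros) (auto simp: floored_solution_def)
  have cl: "closure J = {0..b}"
  proof
    show "closure J \<subseteq> {0..b}" using J by (simp add: closure_minimal)
    show "{0..b} \<subseteq> closure J"
    proof (cases "b = 0")
      case True
      then show ?thesis using D(2) closure_subset[of J] by auto
    next
      case False
      then have "closure {0..<b} = {0..b}" using \<open>0 \<le> b\<close> by simp
      then show ?thesis using closure_mono[OF J(1)] by simp
    qed
  qed
  have m: "m \<le> XL t - y t" if "t \<in> {0..b}" for t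
  proof (rule continuous_ge_on_closure[of J "\<lambda>t. XL t - y t"])
    show "continuous_on (closure J) (\<lambda>t. XL t - y t)"
      using cont \<open>b \<le> T\<close> unfolding cl by (auto elim: continuous_on_subset)
  qed (use that cl gap eq in auto)
  have "b \<in> {0..T}" using \<open>0 \<le> b\<close> \<open>b \<le> T\<close> by simp
  moreover have "0 < m - \<epsilon>" using \<epsilon> by simp
  ultimately obtain d where d: "0 < d"
    "\<And>t. t \<in> {0..T} \<Longrightarrow> dist t b < d \<Longrightarrow> dist (XL t - y t) (XL b - y b) < m - \<epsilon>"
    using cont unfolding continuous_on_iff by blast
  define c where "c = min T (b + d / 2)"
  have c: "0 \<le> c" "c \<le> T" "c \<le> b + d / 2"
    using \<open>0 \<le> b\<close> d(1) pos by (auto simp: c_def)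
  have "sol {0..c} XL y VL w"
  proof (rule floored_solution_imp_sol[OF \<epsilon>(1) c(2) yw c(1)])
    fix t assume t: "t \<in> {0..c}"
    show "\<epsilon> \<le> XL t - y t"
    proof (cases "t \<le> b")
      case True
      then show ?thesis using m[of t] t \<epsilon> by auto
    next
      case False
      then have "dist t b < d" using t c d(1) by (auto simp: dist_real_def)
      then have "dist (XL t - y t) (XL b - y b) < m - \<epsilon>" using d(2) t c by auto
      then show ?thesis using m[of b] \<open>0 \<le> b\<close> by (auto simp: dist_real_def)
    qed
  qed
  moreover have "c = T \<or> b < c \<and> c < T"
    using d(1) by (auto simp: c_def)
  ultimately show thesis using that by blast
qed

text \<open>By uniqueness the solutions on the intervals \<open>[0, r]\<close> agree where they overlap, so the diagonal
  \<open>t \<mapsto> X t t\<close> coincides on \<open>[0, r]\<close> with the solution \<open>X r\<close>.\<close>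
lemma sol_glue:
  assumes "0 < b" "b \<le> T" and ex: "\<And>t. t \<in> {0..<b} \<Longrightarrow> \<exists>x v. sol {0..t} XL x VL v"
  shows "\<exists>x v. sol {0..<b} XL x VL v"
proof -
  obtain X V where XV: "\<And>t. t \<in> {0..<b} \<Longrightarrow> sol {0..t} XL (X t) VL (V t)"
    using ex by metis
  define x where "x t = X t t" for t
  define v where "v t = V t t" for t
  have agree: "x t = X r t" "v t = V r t" if "t \<in> {0..r}" "r \<in> {0..<b}" for t r
    using sol_unique[OF XV XV, of t r t] that by (auto simp: x_def v_def)
  have cont: "continuous_on {0..<b} f"
    if f: "\<And>t r. t \<in> {0..r} \<Longrightarrow> r \<in> {0..<b} \<Longrightarrow> f t = F r t"
      and F: "\<And>r. r \<in> {0..<b} \<Longrightarrow> continuous_on {0..r} (F r)" for f :: "real \<Rightarrow> real" and F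
    unfolding continuous_on_eq_continuous_within
  proof
    fix t assume t: "t \<in> {0..<b}"
    define r where "r = (t + b) / 2"
    have r: "t < r" "r \<in> {0..<b}" using t by (auto simp: r_def field_simps)
    have "continuous_on {0..r} f"
      using continuous_on_cong[of "{0..r}" "{0..r}" f "F r"] f r F by auto
    then have "continuous (at t within {0..r}) f"
      using t r by (auto simp: continuous_on_eq_continuous_within)
    moreover have "at t within {0..r} = at t within {0..<b}"
      by (rule at_within_nhd[of _ "{..<r}"]) (use r in auto)
    ultimately show "continuous (at t within {0..<b}) f" by simp
  qed
  have "sol {0..<b} XL x VL v"
  proof (rule solutionI)
    show "continuous_on {0..<b} x" "continuous_on {0..<b} v"
      by (rule cont[where F = X], use agree solD(4)[OF XV] in auto)
        (rule cont[where F = V], use agree solD(5)[OF XV] in auto)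
    fix t assume t: "t \<in> {0..<b}"
    then have tt: "t \<in> {0..t}" by auto
    note D = solD[OF XV[OF t]]
    show "x t < XL t" "v t \<in> {0..vmax}"
      using D(6,7)[OF tt] by (simp_all add: x_def v_def)
    have "integral {0..t} v = integral {0..t} (V t)"
      using agree t by (intro integral_cong) auto
    then show "x t = x0 + integral {0..t} v"
      using D(8)[OF tt] by (simp add: x_def)
    have "integral {0..t} (\<lambda>s. acceleration kv kd k \<tau>s (XL s) (x s) (VL s) (v s) (u s)) =
        integral {0..t} (\<lambda>s. acceleration kv kd k \<tau>s (XL s) (X t s) (VL s) (V t s) (u s))"
      using agree t by (intro integral_cong) auto
    then show "v t = v0 + integral {0..t}
        (\<lambda>s. acceleration kv kd k \<tau>s (XL s) (x s) (VL s) (v s) (u s))"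
      using D(9)[OF tt] by (simp add: v_def)
  qed (use assms in \<open>auto simp: is_interval_1\<close>)
  then show ?thesis by blast
qed

lemma initial_sol: "sol {0..0} XL (\<lambda>_. x0) VL (\<lambda>_. v0)"
proof (rule solutionI)
  show "is_interval {0..0::real}" by (rule is_interval_cc)
qed (use init pos in \<open>auto simp: state_space_def XL_def\<close>)

text \<open>The leader moves at speed at most \<open>vmax\<close> and the follower never moves backwards.\<close>
lemma sol_gap_increment:
  assumes s: "sol J xl x vl v" and "r \<in> J" "t \<in> J" "r \<le> t"
  shows "XL t - x t \<le> XL r - x r + vmax * (t - r)"
proof -
  note D = solD[OF s]
  have sub: "{0..t} \<subseteq> J" "0 \<le> r" "t \<le> T"
    using mem_is_interval_1_I[OF D(1,2) \<open>t \<in> J\<close>] D(3) \<open>r \<in> J\<close> \<open>t \<in> J\<close> by auto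
  have i: "VL integrable_on {0..t}" "v integrable_on {0..t}"
    using VL_cont D(5) sub by (auto intro!: integrable_continuous_real elim: continuous_on_subset)
  have "VL integrable_on {r..t}" "v integrable_on {r..t}"
    using i sub by (auto elim: integrable_on_subinterval)
  moreover have "VL q \<le> vmax" "0 \<le> v q" if "q \<in> {r..t}" for q
    using that VL_range[of q] D(7)[of q] subsetD[OF sub(1), of q] sub by auto
  ultimately have "integral {r..t} VL \<le> vmax * (t - r)" "0 \<le> integral {r..t} v"
    using integral_le[of VL "{r..t}" "\<lambda>_. vmax"] integral_nonneg[of v "{r..t}"] \<open>r \<le> t\<close>
    by (auto simp: mult.commute)
  moreover have "integral {0..t} VL = integral {0..r} VL + integral {r..t} VL"
    "integral {0..t} v = integral {0..r} v + integral {r..t} v"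
    using Henstock_Kurzweil_Integration.integral_combine[OF sub(2) \<open>r \<le> t\<close>] i
    by (metis (no_types))+
  ultimately show ?thesis
    using D(8)[OF \<open>r \<in> J\<close>] D(8)[OF \<open>t \<in> J\<close>] by (simp add: XL_def)
qed

text \<open>Gaps below the minimum over \<open>[0, b - d]\<close> can occur only after \<open>b - d\<close>, and the remaining time
  \<open>d\<close> is too short for a small gap to grow back.\<close>
lemma sol_gap_tendsto_0:
  assumes s: "sol {0..<b} XL x VL v"
    and small: "\<And>m. 0 < m \<Longrightarrow> \<exists>t\<in>{0..<b}. XL t - x t < m"
  shows "((\<lambda>t. XL t - x t) \<longlongrightarrow> 0) (at_left b)"
proof (rule tendstoI)
  fix e :: real assume "0 < e"
  note D = solD[OF s]
  have "0 < b" using D(2) by auto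
  \<comment> \<open>Within time \<open>d\<close> the gap grows by at most \<open>e / 2\<close>.\<close>
  define d where "d = min b (e / (2 * vmax))"
  have d: "0 < d" "d \<le> b" "vmax * d \<le> e / 2"
    using \<open>0 < b\<close> \<open>0 < e\<close> vmax_pos by (auto simp: d_def min_def field_simps)
  have sub: "{0..b - d} \<subseteq> {0..<b}" using d(1) by auto
  obtain m where m: "0 < m" "\<And>t. t \<in> {0..b - d} \<Longrightarrow> m \<le> XL t - x t"
    using sol_gap_bound[OF s sub] by blast
  obtain r where r: "r \<in> {0..<b}" "XL r - x r < min m (e / 2)"
    using small[of "min m (e / 2)"] m \<open>0 < e\<close> by auto
  have "b - d < r" using m(2)[of r] r by (cases "b - d < r") auto
  have "dist (XL t - x t) 0 < e" if "t \<in> {r<..<b}" for t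
  proof -
    have t: "t \<in> {0..<b}" using that r by auto
    have "XL t - x t \<le> XL r - x r + vmax * (t - r)"
      using sol_gap_increment[OF s r(1) t] that by auto
    moreover have "vmax * (t - r) \<le> vmax * d"
      using that \<open>b - d < r\<close> vmax_pos by (intro mult_left_mono) auto
    ultimately have "XL t - x t < e" using r(2) d(3) by auto
    then show ?thesis using D(6)[OF t] by (simp add: dist_real_def)
  qed
  then show "\<forall>\<^sub>F t in at_left b. dist (XL t - x t) 0 < e"
    using r(1) by (intro eventually_at_leftI[of r]) auto
qed

lemma sol_gap_not_tendsto_0:
  assumes s: "sol J xl x vl v" and t: "t \<in> J" "0 < t"
  shows "\<not> ((\<lambda>r. XL r - x r) \<longlongrightarrow> 0) (at t within J)"
proof
  note D = solD[OF s]
  assume lim: "((\<lambda>r. XL r - x r) \<longlongrightarrow> 0) (at t within J)"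
  have sub: "{0..t} \<subseteq> J" using mem_is_interval_1_I[OF D(1,2) t(1)] by auto
  have "continuous_on J (\<lambda>r. XL r - x r)"
    using D(3,4) XL_cont by (auto intro!: continuous_intros elim: continuous_on_subset)
  then have "((\<lambda>r. XL r - x r) \<longlongrightarrow> XL t - x t) (at t within J)"
    using t by (simp add: continuous_on_def)
  moreover have "at t within J \<noteq> bot"
    using at_le[OF sub, of t] t(2) by (auto simp: at_within_Icc_at_left bot_unique)
  ultimately have "XL t - x t = 0"
    using lim tendsto_unique by blast
  then show False using D(6)[OF t(1)] by simp
qed

text \<open>The alternative is whether a solution reaches \<open>T\<close>. If none does, the collision time is the
  supremum \<open>b\<close> of the times that solutions reach: \<open>no_ext\<close> says that a gap bounded away from \<open>0\<close>
  up to \<open>b\<close> would allow continuation past the supremum or up to \<open>T\<close>.\<close>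
lemma collision_dichotomy:
  "(\<exists>x v. sol {0..T} XL x VL v \<and> collision_time {0..T} XL x > ereal T)
   \<or> (\<exists>b x v. 0 < b \<and> b \<le> T \<and> sol {0..<b} XL x VL v
        \<and> ((\<lambda>t. XL t - x t) \<longlongrightarrow> 0) (at_left b) \<and> collision_time {0..<b} XL x = ereal b)"
proof (cases "\<exists>x v. sol {0..T} XL x VL v")
  case True
  then obtain x v where s: "sol {0..T} XL x VL v" by blast
  have "{t. t > 0 \<and> t \<in> closure {0..T} \<and> ((\<lambda>s. XL s - x s) \<longlongrightarrow> 0) (at t within {0..T})} = {}"
    using sol_gap_not_tendsto_0[OF s] by auto
  then have "collision_time {0..T} XL x = \<infinity>"
    by (simp only: collision_time_def image_empty Inf_empty top_ereal_def)
  with s show ?thesis by auto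
next
  case False
  define P where "P = {b \<in> {0..T}. \<exists>x v. sol {0..b} XL x VL v}"
  define b where "b = Sup P"
  have bdd: "bdd_above P" by (rule bdd_aboveI[of _ T]) (auto simp: P_def)
  have "T \<notin> P" using False by (auto simp: P_def)
  have "0 \<in> {0..T}" using pos by simp
  with initial_sol have 0: "0 \<in> P" unfolding P_def by blast
  have no_ext: False
    if s: "sol J xl x vl v" "{0..<b'} \<subseteq> J" "J \<subseteq> {0..b'}" "b' \<le> T" "0 < m" "b \<le> b'"
      and gap: "\<And>t. t \<in> J \<Longrightarrow> m \<le> XL t - x t" for J xl x vl v b' m
  proof (rule sol_extend[OF s(1-5) gap])
    fix c y w assume c: "c = T \<or> b' < c \<and> c < T" and y: "sol {0..c} XL y VL w"
    have "0 \<le> c" using solD(2)[OF y] by simp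
    with c y False have "b' < c" "c \<in> P" by (auto simp: P_def)
    with cSup_upper[OF _ bdd] \<open>b \<le> b'\<close> show False by (force simp: b_def)
  qed
  have "b \<le> T" unfolding b_def 
  proof (rule cSup_least)
    show "P \<noteq> {}" using 0 by blast
  qed (simp add: P_def)
  \<comment> \<open>The constant solution on the degenerate interval \<open>{0}\<close> has a positive gap, so it continues.\<close>
  have "0 < b"
  proof (rule ccontr)
    assume "\<not> 0 < b"
    show False
      by (rule no_ext[OF initial_sol, of 0 "xl0 - x0"])
        (use \<open>\<not> 0 < b\<close> pos init in \<open>auto simp: state_space_def XL_def\<close>)
  qed
  have "\<exists>x v. sol {0..t} XL x VL v" if t: "t \<in> {0..<b}" for t
  proof -
    obtain r where "r \<in> P" "t < r"
      using less_cSupD[of P t] 0 t by (auto simp: b_def)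
    then show ?thesis
      using sol_restrict[of "{0..r}" _ _ _ _ "{0..t}"] t by (force simp: P_def is_interval_cc)
  qed
  then obtain x v where s: "sol {0..<b} XL x VL v"
    using sol_glue[OF \<open>0 < b\<close> \<open>b \<le> T\<close>] by blast
  have "\<exists>t\<in>{0..<b}. XL t - x t < m" if "0 < m" for m
    using no_ext[OF s, of b m] that \<open>b \<le> T\<close> by force
  then have lim: "((\<lambda>t. XL t - x t) \<longlongrightarrow> 0) (at_left b)"
    by (rule sol_gap_tendsto_0[OF s])
  have "at b within {0..<b} = at_left b"
    by (rule at_within_nhd[of _ "{0<..}"]) (use \<open>0 < b\<close> in auto)
  with lim sol_gap_not_tendsto_0[OF s]
  have "{t. t > 0 \<and> t \<in> closure {0..<b} \<and> ((\<lambda>s. XL s - x s) \<longlongrightarrow> 0) (at t within {0..<b})} = {b}"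
    using \<open>0 < b\<close> by (auto simp: le_less)
  then have "collision_time {0..<b} XL x = ereal b"
    by (simp only: collision_time_def image_insert image_empty cInf_singleton)
  with s lim \<open>0 < b\<close> \<open>b \<le> T\<close> show ?thesis by blast
qed

end

theorem mainTheorem3:
  fixes kv kd k \<tau>s umin umax vmax T :: real
    and u al :: "real \<Rightarrow> real"
    and xl0 x0 vl0 v0 :: real
  assumes "kv > 0" and "kd > 0" and "k > 0" and "\<tau>s > 0"
    and "0 < umin" and "umin < umax" and "umax < vmax"
    and "T > 0"
    and "continuous_on {0..T} u" and "\<forall>t\<in>{0..T}. u t \<in> {umin..umax}"
    and "continuous_on {0..T} al" and "al \<in> L_infinity {0..T}"
    and "\<forall>t\<in>{0..T}. 0 \<le> vl0 + integral {0..t} al \<and> vl0 + integral {0..t} al \<le> vmax"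
    and "(xl0, x0, vl0, v0) \<in> state_space vmax"
  shows
    "(\<exists>xl x vl v.
        unique_solution kv kd k \<tau>s vmax T u al xl0 x0 vl0 v0 {0..T} xl x vl v \<and>
        collision_time {0..T} xl x > ereal T)
     \<or>
     (\<exists>Tc xl x vl v. 0 < Tc \<and> Tc \<le> T \<and>
        unique_solution kv kd k \<tau>s vmax T u al xl0 x0 vl0 v0 {0..<Tc} xl x vl v \<and>
        ((\<lambda>t. xl t - x t) \<longlongrightarrow> 0) (at_left Tc) \<and>
        collision_time {0..<Tc} xl x = ereal Tc)"
proof -
  interpret car_following kv kd k \<tau>s umin umax vmax T u al xl0 x0 vl0 v0
    by unfold_locales (use assms in auto)
  show ?thesis
    using collision_dichotomy sol_imp_unique_solution by blast
qed

end
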